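(* Let $M\ge1$ and, for $m=1,\dots,M$, let $f_{\{0,m\}},f_{\{1,m\}}$ be probability densities on $\mathbb{R}$ with $0<\mathbf{I}(f_{\{1,m\}}\|f_{\{0,m\}})<\infty$ and $0<\mathbf{I}(f_{\{0,m\}}\|f_{\{1,m\}})<\infty$. Let $a>0$, $a_1<a$ and $0<\epsilon_{\{m,1\}}\le1$ for $m=1,\dots,M$, and let $T_c^{\mathcal{M}}(a)$ and $\Psi^{\mathcal{M}}$ be the stopping time and the censoring policy of the multi-sensor CuSum-AC algorithm with these parameters. Then $T_c^{\mathcal{M}}(a)$ is an equalizer rule for Lorden's detection delay, i.e., for any $\nu\ge1$, $$d_L(T_c^{\mathcal{M}}(a),\Psi^{\mathcal{M}})=\operatorname*{ess\,sup}_{\mathcal{I}^{\mathcal{M}}_{\nu-1}}\mathbb{E}_\nu\big[(T_c^{\mathcal{M}}(a)-\nu+1)^+\,\big|\,\mathcal{I}^{\mathcal{M}}_{\nu-1}\big].$$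
   Context: Observation model. There are $M$ sensors; sensor $m$ observes real random variables $X_{\{m,1\}},X_{\{m,2\}},\dots$. For $\nu\in\mathbb{N}_+=\{1,2,\dots\}$, under $\mathbb{P}_\nu$ all $X_{\{m,k\}}$ are independent (over $m$ and $k$), $X_{\{m,k\}}$ has density $f_{\{0,m\}}$ for $k<\nu$ and $f_{\{1,m\}}$ for $k\ge\nu$; under $\mathbb{P}_\infty$ every $X_{\{m,k\}}$ has density $f_{\{0,m\}}$. $\mathbb{E}_\nu,\mathbb{E}_\infty$ are the expectations; $\mathbf{I}(f\|g)=\int f\ln(f/g)\,dx$; $(x)^+=\max(0,x)$. Censoring strategies. A censoring strategy is a (measurable) map $\psi:\mathbb{R}\to\{0,1\}$. At time $k$ sensor $m$ uses a strategy $\psi_{\{m,k\}}$, and $\gamma_{\{m,k\}}=\psi_{\{m,k\}}(X_{\{m,k\}})$; $X_{\{m,k\}}$ is transmitted iff $\gamma_{\{m,k\}}=1$. $\mathcal{I}^m_k=\{(j,\gamma_{\{m,j\}},\gamma_{\{m,j\}}X_{\{m,j\}}):1\le j\le k\}$ and $\mathcal{I}^{\mathcal{M}}_k=\{\mathcal{I}^1_k,\dots,\mathcal{I}^M_k\}$ (empty for $k=0$); the strategies at time $k$ are determined by $\mathcal{I}^{\mathcal{M}}_{k-1}$. For sensor $m$ and strategy $\psi$, $$\ell^{\psi}(\gamma,x)=\gamma\ln\frac{f_{\{1,m\}}(x)}{f_{\{0,m\}}(x)}+(1-\gamma)\ln\frac{\mathbb{P}_1\{\psi(X_{\{m,1\}})=0\}}{\mathbb{P}_\infty\{\psi(X_{\{m,1\}})=0\}}.$$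 For $0<e\le1$ and sensor $m$, $\psi^*(e)$ (depending on $m$) is a fixed maximizer of $\mathbb{E}_1[\ell^\psi(\psi(X_{\{m,1\}}),X_{\{m,1\}})]$ over all $\psi$ with $\mathbb{P}_\infty\{\psi(X_{\{m,1\}})=1\}=e$; $\psi^*(1)\equiv1$. Multi-sensor CuSum-AC algorithm with parameters $a,a_1,\epsilon_{\{1,1\}},\dots,\epsilon_{\{M,1\}}$. Put $s_0^{\mathcal{M}}=0$ and for $k\ge1$ and all $m$: $\psi_{\{m,k\}}=\psi^*(1)$ if $s^{\mathcal{M}}_{k-1}\ge a_1$, and $\psi_{\{m,k\}}=\psi^*(\epsilon_{\{m,1\}})$ otherwise; $\tilde s^{\mathcal{M}}_k=\max\{0,s^{\mathcal{M}}_{k-1}+\sum_{m=1}^M\ell^{\psi_{\{m,k\}}}(\gamma_{\{m,k\}},X_{\{m,k\}})\}$; $s^{\mathcal{M}}_k=a_1$ if $s^{\mathcal{M}}_{k-1}<a_1$ and $\tilde s^{\mathcal{M}}_k\ge a_1$, and $s^{\mathcal{M}}_k=\tilde s^{\mathcal{M}}_k$ otherwise. $\Psi^{\mathcal{M}}$ is the collection of all $\psi_{\{m,k\}}$, and $T_c^{\mathcal{M}}(a)=\inf\{k\ge1:s^{\mathcal{M}}_k\ge a\}$. Lorden's detection delay of a pair $(T,\Psi^{\mathcal{M}})$, $T$ a stopping time with respect to $\sigma(\mathcal{I}_k^{\mathcal{M}})$: $$d_L(T,\Psi^{\mathcal{M}})=\sup_{1\le\nu<\infty}\Big\{\operatorname*{ess\,sup}_{\mathcal{I}^{\mathcal{M}}_{\nu-1}}\mathbb{E}_\nu[(T-\nu+1)^+\mid\mathcal{I}^{\mathcal{M}}_{\nu-1}]\Big\}.$$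 *)

theory Defs
  imports "HOL-Probability.Probability"
begin

definition prob_density :: "(real \<Rightarrow> real) \<Rightarrow> bool" where
  "prob_density f \<longleftrightarrow>
     f \<in> borel_measurable borel \<and> (\<forall>x. 0 \<le> f x) \<and> prob_space (density lborel (\<lambda>x. ennreal (f x)))"

text \<open>
  Kullback-Leibler information \<open>\<integral> f ln (f / g) dx\<close> as an extended real number, with the usual
  conventions \<open>0 ln (0 / g) = 0\<close> and \<open>f ln (f / 0) = \<infinity>\<close> for \<open>f > 0\<close>. The negative part always has
  a finite integral for probability densities, so the difference below is never \<open>\<infinity> - \<infinity>\<close>.
\<close>

definition kl_integrand :: "(real \<Rightarrow> real) \<Rightarrow> (real \<Rightarrow> real) \<Rightarrow> real \<Rightarrow> ereal" where
  "kl_integrand f g x =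
     (if f x = 0 then 0 else if g x = 0 then \<infinity> else ereal (f x * ln (f x / g x)))"

definition kl_info :: "(real \<Rightarrow> real) \<Rightarrow> (real \<Rightarrow> real) \<Rightarrow> ereal" where
  "kl_info f g =
     enn2ereal (\<integral>\<^sup>+ x. e2ennreal (kl_integrand f g x) \<partial>lborel)
     - enn2ereal (\<integral>\<^sup>+ x. e2ennreal (- kl_integrand f g x) \<partial>lborel)"

text \<open>
  Sensors and times are numbered from 1. \<open>P \<nu>\<close> is the law with change point \<open>\<nu>\<close>, and \<open>P \<infinity>\<close> the law
  without change; \<open>P 0\<close> has no meaning and is unconstrained.
\<close>

locale sensor_network =
  fixes M :: nat
    and f0 f1 :: "nat \<Rightarrow> real \<Rightarrow> real"
    and P :: "enat \<Rightarrow> 'a measure"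
    and X :: "nat \<Rightarrow> nat \<Rightarrow> 'a \<Rightarrow> real"
  assumes M_pos: "1 \<le> M"
    and density_f0: "\<And>m. m \<in> {1..M} \<Longrightarrow> prob_density (f0 m)"
    and density_f1: "\<And>m. m \<in> {1..M} \<Longrightarrow> prob_density (f1 m)"
    and prob_P: "\<And>\<nu>. 1 \<le> \<nu> \<Longrightarrow> prob_space (P \<nu>)"
    and sets_P: "\<And>\<nu>. 1 \<le> \<nu> \<Longrightarrow> sets (P \<nu>) = sets (P \<infinity>)"
    and indep_X: "\<And>\<nu>. 1 \<le> \<nu> \<Longrightarrow>
      prob_space.indep_vars (P \<nu>) (\<lambda>_. borel) (\<lambda>(m, k). X m k) ({1..M} \<times> {1..})"
    and distributed_X: "\<And>\<nu> m k. 1 \<le> \<nu> \<Longrightarrow> m \<in> {1..M} \<Longrightarrow> 1 \<le> k \<Longrightarrow>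
      distributed (P \<nu>) lborel (X m k) (\<lambda>x. ennreal (if enat k < \<nu> then f0 m x else f1 m x))"

type_synonym strategy = "real \<Rightarrow> bool"

text \<open>
  A policy gives the strategy of sensor \<open>m\<close> at time \<open>k\<close> for each sample point, so that strategies may
  depend on past observations.
\<close>

type_synonym 'a policy = "nat \<Rightarrow> nat \<Rightarrow> 'a \<Rightarrow> strategy"

text \<open>
  \<open>llr f0 f1 P X m \<psi> \<gamma> x\<close> is \<open>\<ell>\<^sup>\<psi>(\<gamma>, x)\<close> for sensor \<open>m\<close>. It is real-valued: when both informations
  \<open>kl_info (f1 m) (f0 m)\<close> and \<open>kl_info (f0 m) (f1 m)\<close> are finite, the pre- and post-change laws
  are mutually absolutely continuous, so the HOL conventions for \<open>ln 0\<close> and division by \<open>0\<close> only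
  matter on null sets.
\<close>

definition llr ::
  "(nat \<Rightarrow> real \<Rightarrow> real) \<Rightarrow> (nat \<Rightarrow> real \<Rightarrow> real) \<Rightarrow> (enat \<Rightarrow> 'a measure) \<Rightarrow> (nat \<Rightarrow> nat \<Rightarrow> 'a \<Rightarrow> real)
    \<Rightarrow> nat \<Rightarrow> strategy \<Rightarrow> bool \<Rightarrow> real \<Rightarrow> real" where
  "llr f0 f1 P X m \<psi> \<gamma> x =
     of_bool \<gamma> * ln (f1 m x / f0 m x)
     + (1 - of_bool \<gamma>) *
       ln (\<P>(\<omega> in P 1. \<not> \<psi> (X m 1 \<omega>)) / \<P>(\<omega> in P \<infinity>. \<not> \<psi> (X m 1 \<omega>)))"

definition optimal_strategy ::
  "(nat \<Rightarrow> real \<Rightarrow> real) \<Rightarrow> (nat \<Rightarrow> real \<Rightarrow> real) \<Rightarrow> (enat \<Rightarrow> 'a measure) \<Rightarrow> (nat \<Rightarrow> nat \<Rightarrow> 'a \<Rightarrow> real)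
    \<Rightarrow> nat \<Rightarrow> real \<Rightarrow> strategy \<Rightarrow> bool" where
  "optimal_strategy f0 f1 P X m e \<psi>\<^sub>0 \<longleftrightarrow>
     is_arg_max
       (\<lambda>\<psi>. \<integral>\<omega>. llr f0 f1 P X m \<psi> (\<psi> (X m 1 \<omega>)) (X m 1 \<omega>) \<partial>P 1)
       (\<lambda>\<psi>. \<psi> \<in> measurable borel (count_space UNIV) \<and> \<P>(\<omega> in P \<infinity>. \<psi> (X m 1 \<omega>)) = e)
       \<psi>\<^sub>0"

definition ac_strategy ::
  "(nat \<Rightarrow> real \<Rightarrow> strategy) \<Rightarrow> real \<Rightarrow> (nat \<Rightarrow> real) \<Rightarrow> nat \<Rightarrow> real \<Rightarrow> strategy" where
  "ac_strategy \<psi>opt a1 \<epsilon> m s = (if a1 \<le> s then \<psi>opt m 1 else \<psi>opt m (\<epsilon> m))"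

primrec ac_stat ::
  "nat \<Rightarrow> (nat \<Rightarrow> real \<Rightarrow> real) \<Rightarrow> (nat \<Rightarrow> real \<Rightarrow> real) \<Rightarrow> (enat \<Rightarrow> 'a measure)
    \<Rightarrow> (nat \<Rightarrow> nat \<Rightarrow> 'a \<Rightarrow> real) \<Rightarrow> (nat \<Rightarrow> real \<Rightarrow> strategy) \<Rightarrow> real \<Rightarrow> (nat \<Rightarrow> real)
    \<Rightarrow> nat \<Rightarrow> 'a \<Rightarrow> real" where
  "ac_stat M f0 f1 P X \<psi>opt a1 \<epsilon> 0 \<omega> = 0"
| "ac_stat M f0 f1 P X \<psi>opt a1 \<epsilon> (Suc k) \<omega> =
     (let s = ac_stat M f0 f1 P X \<psi>opt a1 \<epsilon> k \<omega>;
          s' = max 0 (s + (\<Sum>m = 1..M.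
                 let \<psi> = ac_strategy \<psi>opt a1 \<epsilon> m s; x = X m (Suc k) \<omega>
                 in llr f0 f1 P X m \<psi> (\<psi> x) x))
      in if s < a1 \<and> a1 \<le> s' then a1 else s')"

definition ac_policy ::
  "nat \<Rightarrow> (nat \<Rightarrow> real \<Rightarrow> real) \<Rightarrow> (nat \<Rightarrow> real \<Rightarrow> real) \<Rightarrow> (enat \<Rightarrow> 'a measure)
    \<Rightarrow> (nat \<Rightarrow> nat \<Rightarrow> 'a \<Rightarrow> real) \<Rightarrow> (nat \<Rightarrow> real \<Rightarrow> strategy) \<Rightarrow> real \<Rightarrow> (nat \<Rightarrow> real)
    \<Rightarrow> 'a policy" where
  "ac_policy M f0 f1 P X \<psi>opt a1 \<epsilon> m k \<omega> =
     ac_strategy \<psi>opt a1 \<epsilon> m (ac_stat M f0 f1 P X \<psi>opt a1 \<epsilon> (k - 1) \<omega>)"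

definition ac_time ::
  "nat \<Rightarrow> (nat \<Rightarrow> real \<Rightarrow> real) \<Rightarrow> (nat \<Rightarrow> real \<Rightarrow> real) \<Rightarrow> (enat \<Rightarrow> 'a measure)
    \<Rightarrow> (nat \<Rightarrow> nat \<Rightarrow> 'a \<Rightarrow> real) \<Rightarrow> (nat \<Rightarrow> real \<Rightarrow> strategy) \<Rightarrow> real \<Rightarrow> (nat \<Rightarrow> real)
    \<Rightarrow> real \<Rightarrow> 'a \<Rightarrow> enat" where
  "ac_time M f0 f1 P X \<psi>opt a1 \<epsilon> a \<omega> =
     (INF k \<in> {k. 1 \<le> k \<and> a \<le> ac_stat M f0 f1 P X \<psi>opt a1 \<epsilon> k \<omega>}. enat k)"

text \<open>
  The data received up to time \<open>k\<close>: for each sensor \<open>m\<close> and time \<open>1 \<le> j \<le> k\<close> the pair \<open>(\<gamma>, \<gamma> X)\<close>.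
\<close>

definition info ::
  "nat \<Rightarrow> (nat \<Rightarrow> nat \<Rightarrow> 'a \<Rightarrow> real) \<Rightarrow> 'a policy \<Rightarrow> nat \<Rightarrow> 'a \<Rightarrow> (nat \<times> nat \<Rightarrow> bool \<times> real)" where
  "info M X \<Psi> k \<omega> =
     (\<lambda>(m, j) \<in> {1..M} \<times> {1..k}.
        let \<gamma> = \<Psi> m j \<omega> (X m j \<omega>) in (\<gamma>, of_bool \<gamma> * X m j \<omega>))"

definition info_algebra ::
  "nat \<Rightarrow> (nat \<Rightarrow> nat \<Rightarrow> 'a \<Rightarrow> real) \<Rightarrow> 'a policy \<Rightarrow> 'a set \<Rightarrow> nat \<Rightarrow> 'a measure" where
  "info_algebra M X \<Psi> \<Omega> k =
     vimage_algebra \<Omega> (info M X \<Psi> k)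
       (PiM ({1..M} \<times> {1..k}) (\<lambda>_. count_space UNIV \<Otimes>\<^sub>M borel))"

text \<open>
  \<open>worst_case_delay M P X T \<Psi> \<nu>\<close> is \<open>ess sup E\<^sub>\<nu>[(T - \<nu> + 1)\<^sup>+ | I\<^sub>\<nu>\<^sub>-\<^sub>1]\<close>. Subtraction on \<^typ>\<open>enat\<close> is
  truncated at \<open>0\<close>, so \<open>T + 1 - \<nu>\<close> is the positive part (and \<open>\<infinity>\<close> if \<open>T = \<infinity>\<close>).
\<close>

definition worst_case_delay ::
  "nat \<Rightarrow> (enat \<Rightarrow> 'a measure) \<Rightarrow> (nat \<Rightarrow> nat \<Rightarrow> 'a \<Rightarrow> real) \<Rightarrow> ('a \<Rightarrow> enat) \<Rightarrow> 'a policy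
    \<Rightarrow> nat \<Rightarrow> ennreal" where
  "worst_case_delay M P X T \<Psi> \<nu> =
     esssup (P (enat \<nu>))
       (nn_cond_exp (P (enat \<nu>)) (info_algebra M X \<Psi> (space (P (enat \<nu>))) (\<nu> - 1))
         (\<lambda>\<omega>. ennreal_of_enat (T \<omega> + 1 - enat \<nu>)))"

definition lorden_delay ::
  "nat \<Rightarrow> (enat \<Rightarrow> 'a measure) \<Rightarrow> (nat \<Rightarrow> nat \<Rightarrow> 'a \<Rightarrow> real) \<Rightarrow> ('a \<Rightarrow> enat) \<Rightarrow> 'a policy \<Rightarrow> ennreal" where
  "lorden_delay M P X T \<Psi> = (SUP \<nu> \<in> {1..}. worst_case_delay M P X T \<Psi> \<nu>)"

end

theory Submission
  imports Defs
begin

text \<open>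
  Let \<open>h s\<close> be the post-change mean number of steps the statistic needs to reach \<open>a\<close> from \<open>s\<close>.
  Given the data received before \<open>\<nu>\<close>, the mean delay is \<open>h (s\<^sub>\<nu>\<^sub>-\<^sub>1)\<close> if the alarm has not been raised
  yet, and \<open>0\<close> otherwise. Since the statistic is reset to \<open>a1\<close> whenever it crosses \<open>a1\<close> from below,
  \<open>h\<close> is antitone, so the delay is at most \<open>h 0\<close>. Before the change, the censored log-likelihood
  ratios are all nonpositive with positive probability, which keeps the statistic at \<open>0\<close>; hence the
  essential supremum is \<open>h 0\<close> for every \<open>\<nu>\<close>.
\<close>

section \<open>The mean run length from a given state\<close>

locale cusum_ac = sensor_network M f0 f1 P X
  for M :: nat
    and f0 f1 :: "nat \<Rightarrow> real \<Rightarrow> real"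
    and P :: "enat \<Rightarrow> 'a measure"
    and X :: "nat \<Rightarrow> nat \<Rightarrow> 'a \<Rightarrow> real" +
  fixes \<psi>opt :: "nat \<Rightarrow> real \<Rightarrow> strategy"
    and a a1 :: real
    and \<epsilon> :: "nat \<Rightarrow> real"
  assumes full_measurable: "m \<in> {1..M} \<Longrightarrow> \<psi>opt m 1 \<in> measurable borel (count_space UNIV)"
    and censored_measurable: "m \<in> {1..M} \<Longrightarrow> \<psi>opt m (\<epsilon> m) \<in> measurable borel (count_space UNIV)"
    and threshold_pos: "0 < a"
    and a1_less: "a1 < a"
begin

abbreviation loglik :: "nat \<Rightarrow> strategy \<Rightarrow> bool \<Rightarrow> real \<Rightarrow> real" where
  "loglik \<equiv> llr f0 f1 P X"

abbreviation strat :: "nat \<Rightarrow> real \<Rightarrow> strategy" where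
  "strat \<equiv> ac_strategy \<psi>opt a1 \<epsilon>"

abbreviation stat :: "nat \<Rightarrow> 'a \<Rightarrow> real" where
  "stat \<equiv> ac_stat M f0 f1 P X \<psi>opt a1 \<epsilon>"

abbreviation policy :: "'a policy" where
  "policy \<equiv> ac_policy M f0 f1 P X \<psi>opt a1 \<epsilon>"

abbreviation stop_time :: "'a \<Rightarrow> enat" where
  "stop_time \<equiv> ac_time M f0 f1 P X \<psi>opt a1 \<epsilon> a"

text \<open>One step is split into the increment, which depends on the state only through the
  strategies in force, and the clamping of the sum, which is monotone in the state on each side of
  \<open>a1\<close>. The comparison of starting points rests on this split.\<close>

definition cap :: "real \<Rightarrow> real \<Rightarrow> real" where
  "cap s z = (if s < a1 \<and> a1 \<le> max 0 (s + z) then a1 else max 0 (s + z))"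

definition increment :: "real \<Rightarrow> (nat \<Rightarrow> real) \<Rightarrow> real" where
  "increment s x = (\<Sum>m = 1..M. loglik m (strat m s) (strat m s (x m)) (x m))"

definition step :: "real \<Rightarrow> (nat \<Rightarrow> real) \<Rightarrow> real" where
  "step s x = cap s (increment s x)"

definition post_change :: "(nat \<Rightarrow> real) measure" where
  "post_change = PiM {1..M} (\<lambda>m. density lborel (\<lambda>x. ennreal (f1 m x)))"

text \<open>
  \<open>mean_run n s\<close> is the post-change mean of the run length, truncated at \<open>n\<close>, of the statistic
  started from \<open>s\<close>.
\<close>

primrec mean_run :: "nat \<Rightarrow> real \<Rightarrow> ennreal" where
  "mean_run 0 s = 0"
| "mean_run (Suc n) s = (if s < a then 1 + (\<integral>\<^sup>+ x. mean_run n (step s x) \<partial>post_change) else 0)"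

text \<open>The statistic becomes the iteration of one map. The observation vector is restricted to
  \<open>{1..M}\<close> so that it is a point of the product space carrying
  \<open>post_change\<close>.\<close>

lemma stat_Suc: "stat (Suc k) \<omega> = step (stat k \<omega>) (\<lambda>m\<in>{1..M}. X m (Suc k) \<omega>)"
proof -
  have "increment s (\<lambda>m\<in>{1..M}. X m (Suc k) \<omega>) =
      (\<Sum>m = 1..M. loglik m (strat m s) (strat m s (X m (Suc k) \<omega>)) (X m (Suc k) \<omega>))" for s
    unfolding increment_def by (intro sum.cong) auto
  then show ?thesis
    by (simp add: step_def cap_def Let_def)
qed

declare ac_stat.simps(2) [simp del]

lemma stat_nonneg: "0 \<le> stat k \<omega>"
  by (induction k) (auto simp: stat_Suc step_def cap_def)

section \<open>Measurability of the step and of the mean run length\<close>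

lemma f1_measurable: "m \<in> {1..M} \<Longrightarrow> f1 m \<in> borel_measurable borel"
  and f0_measurable: "m \<in> {1..M} \<Longrightarrow> f0 m \<in> borel_measurable borel"
  using density_f0 density_f1 by (auto simp: prob_density_def)

lemma f1_nonneg: "m \<in> {1..M} \<Longrightarrow> 0 \<le> f1 m x"
  and f0_nonneg: "m \<in> {1..M} \<Longrightarrow> 0 \<le> f0 m x"
  using density_f0 density_f1 by (auto simp: prob_density_def)

lemma loglik_measurable:
  assumes [measurable]: "g \<in> measurable N (count_space UNIV)" "y \<in> borel_measurable N"
    and m: "m \<in> {1..M}"
  shows "(\<lambda>\<omega>. loglik m \<psi> (g \<omega>) (y \<omega>)) \<in> borel_measurable N"
proof -
  note [measurable] = f0_measurable[OF m] f1_measurable[OF m]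
  show ?thesis
    unfolding llr_def by measurable
qed

text \<open>A sensor only ever uses two strategies, selected by comparing the state with
  \<open>a1\<close>. A case distinction therefore replaces any measurable structure on the set of
  strategies.\<close>

lemma strat_measurable:
  assumes [measurable]: "s \<in> borel_measurable N" "y \<in> borel_measurable N" and m: "m \<in> {1..M}"
  shows "(\<lambda>\<omega>. strat m (s \<omega>) (y \<omega>)) \<in> measurable N (count_space UNIV)"
proof -
  note [measurable] = full_measurable[OF m] censored_measurable[OF m]
  have "(\<lambda>\<omega>. strat m (s \<omega>) (y \<omega>)) = (\<lambda>\<omega>. if a1 \<le> s \<omega> then \<psi>opt m 1 (y \<omega>) else \<psi>opt m (\<epsilon> m) (y \<omega>))"
    by (auto simp: ac_strategy_def)
  then show ?thesis
    by simp
qed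

text \<open>The decision \<open>g\<close> and the observation \<open>y\<close> are separate
  arguments because \<open>stat_received\<close> supplies an observation masked by its
  decision.\<close>

lemma loglik_strat_measurable:
  assumes [measurable]: "s \<in> borel_measurable N" "g \<in> measurable N (count_space UNIV)"
      "y \<in> borel_measurable N" and m: "m \<in> {1..M}"
  shows "(\<lambda>\<omega>. loglik m (strat m (s \<omega>)) (g \<omega>) (y \<omega>)) \<in> borel_measurable N"
proof -
  have [measurable]: "(\<lambda>\<omega>. loglik m \<psi> (g \<omega>) (y \<omega>)) \<in> borel_measurable N" for \<psi>
    by (intro loglik_measurable m) measurable
  have "(\<lambda>\<omega>. loglik m (strat m (s \<omega>)) (g \<omega>) (y \<omega>)) =
      (\<lambda>\<omega>. if a1 \<le> s \<omega> then loglik m (\<psi>opt m 1) (g \<omega>) (y \<omega>)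
           else loglik m (\<psi>opt m (\<epsilon> m)) (g \<omega>) (y \<omega>))"
    by (auto simp: ac_strategy_def)
  then show ?thesis
    by simp
qed

lemma cap_measurable:
  assumes [measurable]: "s \<in> borel_measurable N" "z \<in> borel_measurable N"
  shows "(\<lambda>\<omega>. cap (s \<omega>) (z \<omega>)) \<in> borel_measurable N"
  unfolding cap_def by measurable

lemma step_measurable:
  assumes s: "s \<in> borel_measurable N" and y: "\<And>m. m \<in> {1..M} \<Longrightarrow> (\<lambda>\<omega>. y \<omega> m) \<in> borel_measurable N"
  shows "(\<lambda>\<omega>. step (s \<omega>) (y \<omega>)) \<in> borel_measurable N"
  unfolding step_def increment_def
  by (intro cap_measurable borel_measurable_sum loglik_strat_measurable strat_measurable s y)

lemma sets_post_change [measurable_cong]: "sets post_change = sets (PiM {1..M} (\<lambda>_. borel))"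
  unfolding post_change_def by (intro sets_PiM_cong) auto

lemma prob_space_post_change: "prob_space post_change"
  unfolding post_change_def
proof -
  \<comment> \<open>Nothing is known about \<open>f1 m\<close> for \<open>m\<close> outside
    \<open>{1..M}\<close>. A Dirac measure there makes every member of the family a probability
    measure without changing the product over \<open>{1..M}\<close>.\<close>
  define D where "D = (\<lambda>m. if m \<in> {1..M} then density lborel (\<lambda>x. ennreal (f1 m x)) else return borel 0)"
  have "prob_space (PiM {1..M} D)"
    using density_f1
    by (intro prob_space_PiM) (auto simp: D_def prob_density_def intro: prob_space_return)
  also have "PiM {1..M} D = PiM {1..M} (\<lambda>m. density lborel (\<lambda>x. ennreal (f1 m x)))"
    by (intro PiM_cong) (auto simp: D_def)
  finally show "prob_space \<dots>" .
qed

lemma step_pair_measurable: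
  assumes [measurable]: "s \<in> borel_measurable N"
  shows "(\<lambda>(\<omega>, x). step (s \<omega>) x) \<in> borel_measurable (N \<Otimes>\<^sub>M post_change)"
  unfolding split_beta' by (intro step_measurable) measurable

lemma mean_run_measurable [measurable]: "mean_run n \<in> borel_measurable borel"
proof (induction n)
  case (Suc n)
  interpret Q: prob_space post_change
    by (rule prob_space_post_change)
  have "(\<lambda>(s, x). mean_run n (step s x)) \<in> borel_measurable (borel \<Otimes>\<^sub>M post_change)"
    using measurable_compose[OF step_pair_measurable[OF measurable_ident] Suc]
    by (simp add: split_beta')
  then have [measurable]: "(\<lambda>s. \<integral>\<^sup>+ x. mean_run n (step s x) \<partial>post_change) \<in> borel_measurable borel"
    by (rule Q.borel_measurable_nn_integral)
  show ?case
    by simp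
qed simp

lemma mean_run_step_measurable:
  "(\<lambda>x. mean_run n (step s x)) \<in> borel_measurable post_change"
  by (intro measurable_compose[OF step_measurable mean_run_measurable]) measurable

section \<open>Dependence of the run length on truncation and starting point\<close>

lemma mean_run_mono_Suc: "mean_run n s \<le> mean_run (Suc n) s"
proof (induction n arbitrary: s)
  case (Suc n)
  then have "(\<integral>\<^sup>+ x. mean_run n (step s x) \<partial>post_change) \<le> (\<integral>\<^sup>+ x. mean_run (Suc n) (step s x) \<partial>post_change)"
    by (intro nn_integral_mono)
  then show ?case
    by (simp only: mean_run.simps) (auto intro: add_left_mono)
qed simp

text \<open>One more permitted step prolongs a run by at most that step; the constant 1 passes
  through the integral because \<open>post_change\<close> has mass 1. In
  \<open>mean_run_antimono\<close> this bound is paid for by the step that a start below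
  \<open>a1\<close> needs to get back to \<open>a1\<close>.\<close>

lemma mean_run_Suc_le: "mean_run (Suc n) s \<le> 1 + mean_run n s"
proof (induction n arbitrary: s)
  case (Suc n)
  interpret Q: prob_space post_change
    by (rule prob_space_post_change)
  have "(\<integral>\<^sup>+ x. mean_run (Suc n) (step s x) \<partial>post_change)
      \<le> (\<integral>\<^sup>+ x. 1 + mean_run n (step s x) \<partial>post_change)"
    using Suc by (intro nn_integral_mono)
  also have "\<dots> = 1 + (\<integral>\<^sup>+ x. mean_run n (step s x) \<partial>post_change)"
    by (subst nn_integral_add) (auto intro: mean_run_step_measurable simp: Q.emeasure_space_1)
  finally show ?case
    by (simp only: mean_run.simps) (auto intro: add_left_mono)
qed simp

text \<open>
  The strategies in use differ when \<open>s < a1 \<le> t\<close>. Then the statistic started from \<open>s\<close> cannot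
  overshoot \<open>a1\<close>, so it spends at least one step before it is at best at \<open>a1\<close>.
\<close>

lemma mean_run_antimono: "s \<le> t \<Longrightarrow> mean_run n t \<le> mean_run n s"
proof (induction n arbitrary: s t)
  case (Suc n)
  interpret Q: prob_space post_change
    by (rule prob_space_post_change)
  \<comment> \<open>On one side of \<open>a1\<close> both starting points use the same strategies
    and hence share the increment, and the clamping preserves their order.\<close>
  have same: "mean_run (Suc n) v \<le> mean_run (Suc n) u" if "u \<le> v" "v < a1 \<or> a1 \<le> u" for u v
  proof -
    have "strat m u = strat m v" for m
      using that by (auto simp: ac_strategy_def)
    then have "increment u x = increment v x" for x
      by (simp add: increment_def)
    then have "step u x \<le> step v x" for x
      using that by (auto simp: step_def cap_def)
    then have "(\<integral>\<^sup>+ x. mean_run n (step v x) \<partial>post_change) \<le> (\<integral>\<^sup>+ x. mean_run n (step u x) \<partial>post_change)"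
      by (intro nn_integral_mono Suc)
    then show ?thesis
      using that by (auto intro: add_left_mono)
  qed
  show ?case
  proof (cases "s < a1 \<and> a1 \<le> t")
    case True
    \<comment> \<open>The point \<open>a1\<close> is the intermediary: it lies on the same side as
      \<open>t\<close>, and one step from \<open>s\<close> ends at or below it.\<close>
    then have "mean_run (Suc n) t \<le> mean_run (Suc n) a1"
      by (intro same) auto
    also have "\<dots> \<le> 1 + mean_run n a1"
      by (rule mean_run_Suc_le)
    also have "\<dots> = 1 + (\<integral>\<^sup>+ x. mean_run n a1 \<partial>post_change)"
      by (simp add: Q.emeasure_space_1)
    also have "\<dots> \<le> 1 + (\<integral>\<^sup>+ x. mean_run n (step s x) \<partial>post_change)"
    proof (intro add_left_mono nn_integral_mono Suc)
      show "step s x \<le> a1" for x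
        using True by (auto simp: step_def cap_def)
    qed
    also have "\<dots> = mean_run (Suc n) s"
      using True a1_less by simp
    finally show ?thesis .
  next
    case False
    then show ?thesis
      using same Suc.prems by (meson leD leI)
  qed
qed simp

text \<open>The function \<open>h\<close> of the overview. As a supremum of truncations it inherits
  what induction on \<open>n\<close> proves, and it may be infinite.\<close>

definition mean_delay :: "real \<Rightarrow> ennreal" where
  "mean_delay s = (SUP n. mean_run n s)"

lemma mean_delay_antimono: "s \<le> t \<Longrightarrow> mean_delay t \<le> mean_delay s"
  unfolding mean_delay_def by (intro SUP_mono') (rule mean_run_antimono)

lemma mean_delay_measurable [measurable]: "mean_delay \<in> borel_measurable borel"
  unfolding mean_delay_def by measurable

section \<open>Filtrations and the run length\<close>

text \<open>The raw past, censored observations included. Independence of the next observation is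
  available for this algebra, while the delay is conditioned on the smaller
  \<open>received_algebra\<close>.\<close>

definition obs_algebra :: "nat \<Rightarrow> 'a measure" where
  "obs_algebra k = vimage_algebra (space (P \<infinity>)) (\<lambda>\<omega>. \<lambda>(m, j)\<in>{1..M} \<times> {1..k}. X m j \<omega>)
     (PiM ({1..M} \<times> {1..k}) (\<lambda>_. borel))"

abbreviation received_algebra :: "nat \<Rightarrow> 'a measure" where
  "received_algebra k \<equiv> info_algebra M X policy (space (P \<infinity>)) k"

definition alive :: "nat \<Rightarrow> 'a \<Rightarrow> bool" where
  "alive k \<omega> \<longleftrightarrow> (\<forall>j\<in>{1..k}. stat j \<omega> < a)"

lemma space_obs [simp]: "space (obs_algebra k) = space (P \<infinity>)"
  by (simp add: obs_algebra_def)

lemma space_received [simp]: "space (received_algebra k) = space (P \<infinity>)"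
  by (simp add: info_algebra_def)

lemma space_P: "1 \<le> \<nu> \<Longrightarrow> space (P \<nu>) = space (P \<infinity>)"
  by (rule sets_eq_imp_space_eq[OF sets_P])

lemma X_measurable: "1 \<le> \<nu> \<Longrightarrow> m \<in> {1..M} \<Longrightarrow> 1 \<le> j \<Longrightarrow> X m j \<in> borel_measurable (P \<nu>)"
  using distributed_measurable[OF distributed_X] by simp

lemma X_obs:
  assumes "m \<in> {1..M}" "j \<in> {1..k}"
  shows "X m j \<in> borel_measurable (obs_algebra k)"
proof -
  have 1: "(\<lambda>\<omega>. \<lambda>(m, j)\<in>{1..M} \<times> {1..k}. X m j \<omega>)
      \<in> measurable (obs_algebra k) (PiM ({1..M} \<times> {1..k}) (\<lambda>_. borel))"
    unfolding obs_algebra_def by (rule measurable_vimage_algebra1) (simp add: space_PiM)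
  have 2: "(\<lambda>x. x (m, j)) \<in> measurable (PiM ({1..M} \<times> {1..k}) (\<lambda>_. borel)) borel"
    using assms by (intro measurable_component_singleton) simp
  from measurable_compose[OF 1 2] show ?thesis
    using assms by simp
qed

lemma sets_obs_subset:
  assumes "space N = space (P \<infinity>)"
    and "\<And>m j. m \<in> {1..M} \<Longrightarrow> j \<in> {1..k} \<Longrightarrow> X m j \<in> borel_measurable N"
  shows "sets (obs_algebra k) \<subseteq> sets N"
  unfolding obs_algebra_def using assms
  by (intro sets_image_in_sets measurable_restrict) auto

lemma sets_obs_mono: "k \<le> n \<Longrightarrow> sets (obs_algebra k) \<subseteq> sets (obs_algebra n)"
  by (intro sets_obs_subset X_obs) auto

lemma sets_obs_P: "1 \<le> \<nu> \<Longrightarrow> sets (obs_algebra k) \<subseteq> sets (P \<nu>)"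
  by (intro sets_obs_subset X_measurable space_P) auto

lemma stat_obs: "j \<le> k \<Longrightarrow> stat j \<in> borel_measurable (obs_algebra k)"
proof (induction j)
  case 0
  then show ?case by simp
next
  case (Suc j)
  then show ?case
    unfolding stat_Suc[abs_def]
    by (intro step_measurable) (auto intro!: X_obs)
qed

text \<open>The decision at time \<open>j\<close> applies a strategy selected by
  \<open>stat (j - 1)\<close> to the observation at time \<open>j\<close>, so it is a function of
  the raw observations up to \<open>k\<close>.\<close>

lemma info_obs:
  "info M X policy k \<in> measurable (obs_algebra k)
     (PiM ({1..M} \<times> {1..k}) (\<lambda>_. count_space UNIV \<Otimes>\<^sub>M borel))"
  unfolding info_def[abs_def] Let_def
proof (intro measurable_restrict)
  fix i assume i: "i \<in> {1..M} \<times> {1..k}"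
  obtain m j where mj: "i = (m, j)" "m \<in> {1..M}" "j \<in> {1..k}"
    using i by auto
  have [measurable]: "X m j \<in> borel_measurable (obs_algebra k)"
    using mj by (intro X_obs)
  have [measurable]: "(\<lambda>\<omega>. policy m j \<omega> (X m j \<omega>)) \<in> measurable (obs_algebra k) (count_space UNIV)"
    unfolding ac_policy_def using mj by (intro strat_measurable stat_obs) auto
  show "(\<lambda>\<omega>. case i of (m, j) \<Rightarrow>
      (policy m j \<omega> (X m j \<omega>), of_bool (policy m j \<omega> (X m j \<omega>)) * X m j \<omega>))
      \<in> measurable (obs_algebra k) (count_space UNIV \<Otimes>\<^sub>M borel)"
    unfolding mj prod.case of_bool_def by measurable
qed

lemma sets_received_obs: "sets (received_algebra k) \<subseteq> sets (obs_algebra k)"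
  unfolding info_algebra_def by (intro sets_image_in_sets info_obs) simp

lemma received_measurable:
  assumes "m \<in> {1..M}" "j \<in> {1..k}"
  shows "(\<lambda>\<omega>. policy m j \<omega> (X m j \<omega>)) \<in> measurable (received_algebra k) (count_space UNIV)"
    and "(\<lambda>\<omega>. of_bool (policy m j \<omega> (X m j \<omega>)) * X m j \<omega>) \<in> borel_measurable (received_algebra k)"
proof -
  have 1: "info M X policy k \<in> measurable (received_algebra k)
      (PiM ({1..M} \<times> {1..k}) (\<lambda>_. count_space UNIV \<Otimes>\<^sub>M borel))"
    unfolding info_algebra_def
    by (rule measurable_vimage_algebra1) (simp add: space_PiM space_pair_measure info_def)
  have 2: "(\<lambda>x. x (m, j)) \<in> measurable
      (PiM ({1..M} \<times> {1..k}) (\<lambda>_. count_space UNIV \<Otimes>\<^sub>M borel)) (count_space UNIV \<Otimes>\<^sub>M borel)"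
    using assms by (intro measurable_component_singleton) simp
  note 3 = measurable_compose[OF 1 2]
  note * = measurable_compose[OF 3 measurable_fst] measurable_compose[OF 3 measurable_snd]
  show "(\<lambda>\<omega>. policy m j \<omega> (X m j \<omega>)) \<in> measurable (received_algebra k) (count_space UNIV)"
    "(\<lambda>\<omega>. of_bool (policy m j \<omega> (X m j \<omega>)) * X m j \<omega>) \<in> borel_measurable (received_algebra k)"
    using * assms by (simp_all add: info_def Let_def)
qed

text \<open>The log-likelihood ratio of a censored observation is a constant of the strategy, so
  masking the observation by its decision does not change it. Together with the strategy, known from
  the preceding value of the statistic, the received data therefore determine the next
  value.\<close>

lemma stat_received: "j \<le> k \<Longrightarrow> stat j \<in> borel_measurable (received_algebra k)"
proof (induction j)
  case 0
  then show ?case by simp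
next
  case (Suc j)
  have loglik_received: "loglik m \<psi> \<gamma> x = loglik m \<psi> \<gamma> (of_bool \<gamma> * x)" for m \<psi> \<gamma> x
    by (cases \<gamma>) (auto simp: llr_def)
  have "increment (stat j \<omega>) (\<lambda>m\<in>{1..M}. X m (Suc j) \<omega>) =
      (\<Sum>m = 1..M. loglik m (strat m (stat j \<omega>)) (policy m (Suc j) \<omega> (X m (Suc j) \<omega>))
         (of_bool (policy m (Suc j) \<omega> (X m (Suc j) \<omega>)) * X m (Suc j) \<omega>))" for \<omega>
    unfolding increment_def by (intro sum.cong) (auto simp: ac_policy_def loglik_received[symmetric])
  then have "stat (Suc j) = (\<lambda>\<omega>. cap (stat j \<omega>)
      (\<Sum>m = 1..M. loglik m (strat m (stat j \<omega>)) (policy m (Suc j) \<omega> (X m (Suc j) \<omega>))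
         (of_bool (policy m (Suc j) \<omega> (X m (Suc j) \<omega>)) * X m (Suc j) \<omega>)))"
    by (intro ext) (simp only: stat_Suc step_def)
  also have "\<dots> \<in> borel_measurable (received_algebra k)"
    using Suc
    by (intro cap_measurable borel_measurable_sum loglik_strat_measurable received_measurable) auto
  finally show ?case .
qed

lemma alive_received: "Measurable.pred (received_algebra k) (alive k)"
proof -
  have [measurable]: "stat j \<in> borel_measurable (received_algebra k)" if "j \<in> {1..k}" for j
    using that by (intro stat_received) auto
  show ?thesis
    unfolding alive_def[abs_def] by measurable
qed

lemma measurable_obs_received: "f \<in> measurable (received_algebra k) N \<Longrightarrow> f \<in> measurable (obs_algebra k) N"
  using sets_received_obs[of k] by (auto simp: measurable_def)

lemma measurable_P_obs: "1 \<le> \<nu> \<Longrightarrow> f \<in> measurable (obs_algebra k) N \<Longrightarrow> f \<in> measurable (P \<nu>) N"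
  using sets_obs_P[of \<nu> k] space_P[of \<nu>] by (auto simp: measurable_def)

text \<open>The infimum over the empty set is infinite, so a run without alarm is alive at every
  \<open>k\<close>. Survival at \<open>k\<close> is the event that the alarm comes no earlier than
  the change point \<open>Suc k\<close>.\<close>

lemma alive_iff: "alive k \<omega> \<longleftrightarrow> enat k < stop_time \<omega>"
proof -
  have "alive k \<omega> \<longleftrightarrow> (\<forall>j. 1 \<le> j \<and> a \<le> stat j \<omega> \<longrightarrow> Suc k \<le> j)"
    unfolding alive_def Ball_def atLeastAtMost_iff Suc_le_eq by (meson not_le)
  also have "\<dots> \<longleftrightarrow> enat (Suc k) \<le> stop_time \<omega>"
    unfolding ac_time_def le_INF_iff by simp
  finally have "alive k \<omega> \<longleftrightarrow> enat (Suc k) \<le> stop_time \<omega>" .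
  then show ?thesis
    by (simp add: Suc_ile_eq)
qed

text \<open>The number of steps after time \<open>k\<close> up to the alarm, truncated at
  \<open>n\<close>. Written as a sum of indicators it obeys the recursion \<open>delay_Suc\<close>,
  which parallels that of \<open>mean_run\<close>.\<close>

definition delay :: "nat \<Rightarrow> nat \<Rightarrow> 'a \<Rightarrow> ennreal" where
  "delay n k \<omega> = (\<Sum>i<n. indicator {\<omega>. alive (k + i) \<omega>} \<omega>)"

lemma delay_Suc: "delay (Suc n) k \<omega> = indicator {\<omega>. alive k \<omega>} \<omega> + delay n (Suc k) \<omega>"
  unfolding delay_def by (subst sum.lessThan_Suc_shift) simp

lemma delay_eq_card: "delay n k \<omega> = of_nat (card {i\<in>{..<n}. alive (k + i) \<omega>})"
  unfolding delay_def by (simp add: indicator_def sum.If_cases of_bool_def Int_def)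

lemma SUP_delay: "(SUP n. delay n k \<omega>) = ennreal_of_enat (stop_time \<omega> + 1 - enat (Suc k))"
proof (cases "stop_time \<omega>")
  case (enat t)
  \<comment> \<open>Subtraction on naturals is truncated, so an alarm at or before \<open>k\<close>
    correctly yields the empty set.\<close>
  have "{i\<in>{..<n}. alive (k + i) \<omega>} = {..<min n (t - k)}" for n
    using enat by (auto simp: alive_iff)
  then have d: "delay n k \<omega> = of_nat (min n (t - k))" for n
    by (simp add: delay_eq_card)
  have "(SUP n. delay n k \<omega>) = of_nat (t - k)"
  proof (rule antisym)
    show "(SUP n. delay n k \<omega>) \<le> of_nat (t - k)"
      by (auto intro!: SUP_least simp: d)
    show "of_nat (t - k) \<le> (SUP n. delay n k \<omega>)"
      by (rule SUP_upper2[of "t - k"]) (auto simp: d)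
  qed
  then show ?thesis
    by (simp add: enat one_enat_def)
next
  case infinity
  then have "delay n k \<omega> = of_nat n" for n
    by (simp add: delay_eq_card alive_iff)
  then show ?thesis
    by (simp add: infinity ennreal_SUP_of_nat_eq_top)
qed

section \<open>The conditional mean delay\<close>

lemma distr_post_change:
  assumes \<nu>: "1 \<le> \<nu>" "\<nu> \<le> enat k" and k: "1 \<le> k"
  shows "distr (P \<nu>) (PiM {1..M} (\<lambda>_. borel)) (\<lambda>\<omega>. \<lambda>m\<in>{1..M}. X m k \<omega>) = post_change"
proof -
  interpret prob_space "P \<nu>"
    using \<nu> by (intro prob_P)
  \<comment> \<open>Independence is given for families indexed by pairs (sensor, time). The joint
    law is found on this time slice and then reindexed by the sensor alone.\<close>
  define B where "B = {1..M} \<times> {k}"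
  let ?X = "\<lambda>(m, j). X m j"
  let ?D = "\<lambda>i. distr (P \<nu>) borel (?X i)"
  have X: "?X i \<in> borel_measurable (P \<nu>)" if "i \<in> B" for i
    using that k \<nu> by (auto simp: B_def intro: X_measurable)
  have "indep_vars (\<lambda>_. borel) ?X B"
    by (rule indep_vars_subset[OF indep_X]) (use \<nu> k in \<open>auto simp: B_def\<close>)
  moreover have "B \<noteq> {}"
    using M_pos by (auto simp: B_def)
  ultimately have B: "distr (P \<nu>) (PiM B (\<lambda>_. borel)) (\<lambda>\<omega>. \<lambda>i\<in>B. ?X i \<omega>) = PiM B ?D"
    by (simp add: indep_vars_iff_distr_eq_PiM' X)
  have Bm: "(\<lambda>\<omega>. \<lambda>i\<in>B. ?X i \<omega>) \<in> measurable (P \<nu>) (PiM B (\<lambda>_. borel))"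
    by (intro measurable_restrict X)
  have rm: "(\<lambda>x. \<lambda>m\<in>{1..M}. x (m, k)) \<in> measurable (PiM B (\<lambda>_. borel)) (PiM {1..M} (\<lambda>_. borel))"
    by (intro measurable_restrict measurable_component_singleton) (auto simp: B_def)
  have D: "?D (m, k) = density lborel (\<lambda>x. ennreal (f1 m x))" if "m \<in> {1..M}" for m
  proof -
    have "\<not> enat k < \<nu>"
      using \<nu> by simp
    then have "distr (P \<nu>) lborel (X m k) = density lborel (\<lambda>x. ennreal (f1 m x))"
      using distributed_distr_eq_density[OF distributed_X[OF \<nu>(1) that k]] by simp
    then show ?thesis
      by (simp cong: distr_cong)
  qed
  have "distr (P \<nu>) (PiM {1..M} (\<lambda>_. borel)) (\<lambda>\<omega>. \<lambda>m\<in>{1..M}. X m k \<omega>)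
      = distr (PiM B ?D) (PiM {1..M} (\<lambda>_. borel)) (\<lambda>x. \<lambda>m\<in>{1..M}. x (m, k))"
    unfolding B[symmetric] distr_distr[OF rm Bm]
    by (rule arg_cong[of _ _ "distr (P \<nu>) _"]) (auto simp: B_def fun_eq_iff)
  also have "\<dots> = distr (PiM B ?D) (PiM {1..M} (\<lambda>m. ?D (m, k))) (\<lambda>x. \<lambda>m\<in>{1..M}. x (m, k))"
    by (intro distr_cong sets_PiM_cong) auto
  also have "\<dots> = PiM {1..M} (\<lambda>m. ?D (m, k))"
    by (intro distr_PiM_reindex prob_space_distr X) (auto simp: B_def inj_on_def)
  also have "\<dots> = post_change"
    unfolding post_change_def by (intro PiM_cong D) auto
  finally show ?thesis .
qed

text \<open>The past and the next observation vector are built from disjoint blocks of an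
  independent family. This holds wherever the change point lies.\<close>

lemma prob_next_obs:
  assumes \<nu>: "1 \<le> \<nu>" and C: "C \<in> sets (obs_algebra k)" and D: "D \<in> sets (PiM {1..M} (\<lambda>_. borel))"
  defines "E \<equiv> (\<lambda>\<omega>. \<lambda>m\<in>{1..M}. X m (Suc k) \<omega>) -` D \<inter> space (P \<nu>)"
  shows "measure (P \<nu>) (C \<inter> E) = measure (P \<nu>) C * measure (P \<nu>) E"
proof -
  interpret prob_space "P \<nu>"
    using \<nu> by (intro prob_P)
  define A where "A = {1..M} \<times> {1..k}"
  define B where "B = {1..M} \<times> {Suc k}"
  let ?past = "\<lambda>\<omega>. \<lambda>(m, j)\<in>A. X m j \<omega>"
  let ?next = "\<lambda>\<omega>. \<lambda>(m, j)\<in>B. X m j \<omega>"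
  have restrict: "restrict (\<lambda>i. (case i of (m, j) \<Rightarrow> X m j) \<omega>) I = (\<lambda>(m, j)\<in>I. X m j \<omega>)" for I \<omega>
    by (auto simp: fun_eq_iff)
  have ind: "indep_var (PiM A (\<lambda>_. borel)) ?past (PiM B (\<lambda>_. borel)) ?next"
    unfolding restrict[symmetric]
    by (rule indep_var_restrict[OF indep_X[OF \<nu>]]) (auto simp: A_def B_def)
  have "?past \<in> space (P \<infinity>) \<rightarrow> space (PiM A (\<lambda>_. borel))"
    by (simp add: space_PiM)
  then obtain C' where C': "C' \<in> sets (PiM A (\<lambda>_. borel))" "C = ?past -` C' \<inter> space (P \<nu>)"
    using C unfolding obs_algebra_def A_def[symmetric] space_P[OF \<nu>] by (auto simp: sets_vimage_algebra2)
  have f: "(\<lambda>x. \<lambda>m\<in>{1..M}. x (m, Suc k)) \<in> measurable (PiM B (\<lambda>_. borel)) (PiM {1..M} (\<lambda>_. borel))"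
    by (intro measurable_restrict measurable_component_singleton) (auto simp: B_def)
  define D' where "D' = (\<lambda>x. \<lambda>m\<in>{1..M}. x (m, Suc k)) -` D \<inter> space (PiM B (\<lambda>_. borel))"
  have D': "D' \<in> sets (PiM B (\<lambda>_. borel))"
    unfolding D'_def using f D by (rule measurable_sets)
  have "(\<lambda>m\<in>{1..M}. ?next \<omega> (m, Suc k)) = (\<lambda>m\<in>{1..M}. X m (Suc k) \<omega>)" for \<omega>
    by (auto simp: B_def fun_eq_iff)
  then have E: "E = ?next -` D' \<inter> space (P \<nu>)"
    by (auto simp: E_def D'_def space_PiM)
  have "(\<lambda>\<omega>. (?past \<omega>, ?next \<omega>)) -` (C' \<times> D') \<inter> space (P \<nu>) = C \<inter> E"
    using C' E by auto
  then show ?thesis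
    using indep_varD[OF ind C'(1) D'] C' E by simp
qed

text \<open>Fubini for the past and the next observation: by independence their joint law is a
  product, and the second factor is \<open>post_change\<close> since time \<open>Suc k\<close> is
  not before the change.\<close>

lemma nn_integral_next_obs:
  assumes \<nu>: "1 \<le> \<nu>" "\<nu> \<le> enat (Suc k)"
    and F: "F \<in> borel_measurable (obs_algebra k \<Otimes>\<^sub>M post_change)"
  shows "(\<integral>\<^sup>+ \<omega>. F (\<omega>, \<lambda>m\<in>{1..M}. X m (Suc k) \<omega>) \<partial>P \<nu>) = (\<integral>\<^sup>+ \<omega>. \<integral>\<^sup>+ x. F (\<omega>, x) \<partial>post_change \<partial>P \<nu>)"
proof -
  interpret prob_space "P \<nu>"
    using \<nu> by (intro prob_P)
  interpret Q: prob_space post_change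
    by (rule prob_space_post_change)
  let ?next = "\<lambda>\<omega>. \<lambda>m\<in>{1..M}. X m (Suc k) \<omega>"
  let ?id = "\<lambda>\<omega>. \<omega>"
  \<comment> \<open>Pushing forward along the identity restricts \<open>P \<nu>\<close> to the raw
    past, so the sample point itself can play the role of the past.\<close>
  let ?O = "distr (P \<nu>) (obs_algebra k) ?id"
  let ?J = "distr (P \<nu>) (obs_algebra k \<Otimes>\<^sub>M post_change) (\<lambda>\<omega>. (\<omega>, ?next \<omega>))"
  have id [measurable]: "?id \<in> measurable (P \<nu>) (obs_algebra k)"
    by (rule measurable_P_obs[OF \<nu>(1), of _ k]) simp
  have nxt [measurable]: "?next \<in> measurable (P \<nu>) (PiM {1..M} (\<lambda>_. borel))"
    by (intro measurable_restrict X_measurable \<nu>) auto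
  have nxt_post [measurable]: "?next \<in> measurable (P \<nu>) post_change"
    using nxt by (simp cong: measurable_cong_sets add: sets_post_change)
  have pair [measurable]: "(\<lambda>\<omega>. (\<omega>, ?next \<omega>)) \<in> measurable (P \<nu>) (obs_algebra k \<Otimes>\<^sub>M post_change)"
    by (rule measurable_Pair[OF id nxt_post])
  interpret O: prob_space ?O
    by (rule prob_space_distr) (rule id)
  have eq: "?O \<Otimes>\<^sub>M post_change = ?J"
  proof (rule pair_measure_eqI)
    fix C D assume C: "C \<in> sets ?O" and D: "D \<in> sets post_change"
    have C': "C \<in> sets (obs_algebra k)" and D': "D \<in> sets (PiM {1..M} (\<lambda>_. borel))"
      using C D by (auto simp: sets_post_change)
    have "C \<subseteq> space (P \<nu>)"
      using sets.sets_into_space[OF C'] space_P[OF \<nu>(1)] by simp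
    then have int: "(\<lambda>\<omega>. (\<omega>, ?next \<omega>)) -` (C \<times> D) \<inter> space (P \<nu>) = C \<inter> (?next -` D \<inter> space (P \<nu>))"
      "?id -` C \<inter> space (P \<nu>) = C"
      by auto
    have O: "emeasure ?O C = measure (P \<nu>) C"
      using C' int(2) by (simp add: emeasure_distr emeasure_eq_measure)
    have "1 \<le> Suc k" by simp
    note post = distr_post_change[OF \<nu> this]
    have Q: "emeasure post_change D = measure (P \<nu>) (?next -` D \<inter> space (P \<nu>))"
      unfolding post[symmetric] emeasure_distr[OF nxt D'] by (rule emeasure_eq_measure)
    have J: "emeasure ?J (C \<times> D) = measure (P \<nu>) (C \<inter> (?next -` D \<inter> space (P \<nu>)))"
      using C' D
      by (subst emeasure_distr[OF pair]) (simp_all only: int emeasure_eq_measure pair_measureI)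
    show "emeasure ?O C * emeasure post_change D = emeasure ?J (C \<times> D)"
      unfolding O Q J prob_next_obs[OF \<nu>(1) C' D'] by (simp add: ennreal_mult)
  qed (simp_all add: O.sigma_finite_measure_axioms Q.sigma_finite_measure_axioms cong: sets_pair_measure_cong)
  have F': "F \<in> borel_measurable (?O \<Otimes>\<^sub>M post_change)"
    using F by (simp add: eq)
  have "(\<integral>\<^sup>+ \<omega>. F (\<omega>, ?next \<omega>) \<partial>P \<nu>) = integral\<^sup>N ?J F"
    using F by (intro nn_integral_distr[OF pair, symmetric]) simp
  also have "\<dots> = integral\<^sup>N (?O \<Otimes>\<^sub>M post_change) F"
    by (simp only: eq)
  also have "\<dots> = (\<integral>\<^sup>+ \<omega>. \<integral>\<^sup>+ x. F (\<omega>, x) \<partial>post_change \<partial>?O)"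
    by (rule Q.nn_integral_fst[OF F', symmetric])
  also have "\<dots> = (\<integral>\<^sup>+ \<omega>. \<integral>\<^sup>+ x. F (\<omega>, x) \<partial>post_change \<partial>P \<nu>)"
    using Q.borel_measurable_nn_integral_fst[OF F] id by (subst nn_integral_distr) auto
  finally show ?thesis .
qed

section \<open>The Markov property and the conditional delay\<close>

lemma alive_obs: "Measurable.pred (obs_algebra k) (alive k)"
  by (rule measurable_obs_received[OF alive_received])

lemma alive_Suc: "alive (Suc k) \<omega> \<longleftrightarrow> alive k \<omega> \<and> stat (Suc k) \<omega> < a"
  by (auto simp: alive_def le_Suc_eq)

lemma alive_stat: "alive k \<omega> \<Longrightarrow> stat k \<omega> < a"
  \<comment> \<open>Being alive at time 0 is vacuous; there the claim is
    \<open>0 < a\<close>.\<close>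
  using threshold_pos by (cases k) (auto simp: alive_def)

lemma mean_run_above: "\<not> s < a \<Longrightarrow> mean_run n s = 0"
  by (cases n) auto

lemma delay_measurable: "1 \<le> \<nu> \<Longrightarrow> delay n k \<in> borel_measurable (P \<nu>)"
proof -
  assume \<nu>: "1 \<le> \<nu>"
  have [measurable]: "Measurable.pred (P \<nu>) (alive k)" for k
    by (rule measurable_P_obs[OF \<nu> alive_obs])
  show ?thesis
    unfolding delay_def[abs_def] by measurable
qed

text \<open>The Markov property in truncated form. The first step is split off, the induction
  hypothesis is applied at \<open>Suc k\<close> to the same event, which also lies in the larger
  algebra, and the observation at time \<open>Suc k\<close> is integrated out.\<close>

lemma nn_integral_delay:
  assumes \<nu>: "1 \<le> \<nu>" "\<nu> \<le> enat (Suc k)" and A: "A \<in> sets (obs_algebra k)"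
  shows "(\<integral>\<^sup>+ \<omega>\<in>A. delay n k \<omega> \<partial>P \<nu>) =
    (\<integral>\<^sup>+ \<omega>\<in>A. indicator {\<omega>. alive k \<omega>} \<omega> * mean_run n (stat k \<omega>) \<partial>P \<nu>)"
  using \<nu>(2) A
proof (induction n arbitrary: k A)
  case 0
  then show ?case
    by (simp add: delay_def)
next
  case (Suc n k A)
  interpret Q: prob_space post_change
    by (rule prob_space_post_change)
  define B where "B = {\<omega> \<in> A. alive k \<omega>}"
  have A_subset: "A \<subseteq> space (P \<infinity>)"
    using sets.sets_into_space[OF Suc.prems(2)] by simp
  have B: "B \<in> sets (obs_algebra k)"
  proof -
    have "B = A \<inter> {\<omega> \<in> space (obs_algebra k). alive k \<omega>}"
      using A_subset by (auto simp: B_def)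
    then show ?thesis
      using Suc.prems(2) alive_obs[of k] by (auto simp: pred_def)
  qed
  have B_P [measurable]: "B \<in> sets (P \<nu>)"
    using sets_obs_P[OF \<nu>(1)] B by blast
  have A_P [measurable]: "A \<in> sets (P \<nu>)"
    using sets_obs_P[OF \<nu>(1)] Suc.prems(2) by blast
  have \<nu>_Suc: "\<nu> \<le> enat (Suc (Suc k))"
    using Suc.prems(1) by (rule order_trans) simp
  have A_Suc: "A \<in> sets (obs_algebra (Suc k))"
    using sets_obs_mono[of k "Suc k"] Suc.prems(2) by auto
  have [measurable]: "delay n j \<in> borel_measurable (P \<nu>)" for j
    by (rule delay_measurable[OF \<nu>(1)])
  have stat [measurable]: "stat k \<in> borel_measurable (obs_algebra k)"
    by (rule stat_obs) simp
  have [measurable]: "stat k \<in> borel_measurable (P \<nu>)"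
    by (rule measurable_P_obs[OF \<nu>(1) stat])
  define F where "F = (\<lambda>(\<omega>, x). mean_run n (step (stat k \<omega>) x) * indicator B \<omega>)"
  have [measurable]: "(\<lambda>p. step (stat k (fst p)) (snd p)) \<in> borel_measurable (obs_algebra k \<Otimes>\<^sub>M post_change)"
    using step_pair_measurable[OF stat] by (simp add: split_beta')
  have F: "F \<in> borel_measurable (obs_algebra k \<Otimes>\<^sub>M post_change)"
    unfolding F_def split_beta' using B by measurable
  have "(\<integral>\<^sup>+ \<omega>\<in>A. delay n (Suc k) \<omega> \<partial>P \<nu>) =
      (\<integral>\<^sup>+ \<omega>\<in>A. indicator {\<omega>. alive (Suc k) \<omega>} \<omega> * mean_run n (stat (Suc k) \<omega>) \<partial>P \<nu>)"
    by (rule Suc.IH[OF \<nu>_Suc A_Suc])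
  \<comment> \<open>Survival of the step \<open>Suc k\<close> need not be recorded in
    \<open>F\<close>: once the statistic has reached \<open>a\<close>, \<open>mean_run\<close>
    vanishes.\<close>
  also have "\<dots> = (\<integral>\<^sup>+ \<omega>. F (\<omega>, \<lambda>m\<in>{1..M}. X m (Suc k) \<omega>) \<partial>P \<nu>)"
    unfolding F_def prod.case stat_Suc[symmetric]
    by (intro nn_integral_cong) (auto simp: B_def alive_Suc indicator_def mean_run_above)
  also have "\<dots> = (\<integral>\<^sup>+ \<omega>. \<integral>\<^sup>+ x. F (\<omega>, x) \<partial>post_change \<partial>P \<nu>)"
    by (rule nn_integral_next_obs[OF \<nu>(1) Suc.prems(1) F])
  also have "\<dots> = (\<integral>\<^sup>+ \<omega>\<in>B. (\<integral>\<^sup>+ x. mean_run n (step (stat k \<omega>) x) \<partial>post_change) \<partial>P \<nu>)"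
    unfolding F_def prod.case
    by (intro nn_integral_cong nn_integral_multc mean_run_step_measurable)
  finally have next_delay: "(\<integral>\<^sup>+ \<omega>\<in>A. delay n (Suc k) \<omega> \<partial>P \<nu>) =
      (\<integral>\<^sup>+ \<omega>\<in>B. (\<integral>\<^sup>+ x. mean_run n (step (stat k \<omega>) x) \<partial>post_change) \<partial>P \<nu>)" .
  have [measurable]: "(\<lambda>\<omega>. \<integral>\<^sup>+ x. mean_run n (step (stat k \<omega>) x) \<partial>post_change) \<in> borel_measurable (P \<nu>)"
    by (intro measurable_P_obs[OF \<nu>(1), of _ k] Q.borel_measurable_nn_integral) (simp add: split_beta')
  have "(\<integral>\<^sup>+ \<omega>\<in>A. delay (Suc n) k \<omega> \<partial>P \<nu>) =
      (\<integral>\<^sup>+ \<omega>. indicator B \<omega> + delay n (Suc k) \<omega> * indicator A \<omega> \<partial>P \<nu>)"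
    by (intro nn_integral_cong) (auto simp: delay_Suc B_def indicator_def)
  also have "\<dots> = (\<integral>\<^sup>+ \<omega>. indicator B \<omega> \<partial>P \<nu>) + (\<integral>\<^sup>+ \<omega>\<in>A. delay n (Suc k) \<omega> \<partial>P \<nu>)"
    by (intro nn_integral_add) auto
  also have "\<dots> = (\<integral>\<^sup>+ \<omega>. indicator B \<omega>
      + (\<integral>\<^sup>+ x. mean_run n (step (stat k \<omega>) x) \<partial>post_change) * indicator B \<omega> \<partial>P \<nu>)"
    unfolding next_delay by (intro nn_integral_add[symmetric]) auto
  \<comment> \<open>On \<open>B\<close> the statistic is below \<open>a\<close>, so the recursion
    for \<open>mean_run (Suc n)\<close> takes its first branch.\<close>
  also have "\<dots> = (\<integral>\<^sup>+ \<omega>\<in>A. indicator {\<omega>. alive k \<omega>} \<omega> * mean_run (Suc n) (stat k \<omega>) \<partial>P \<nu>)"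
    by (intro nn_integral_cong) (auto simp: B_def indicator_def alive_stat)
  finally show ?case .
qed

lemma received_subalgebra: "1 \<le> \<nu> \<Longrightarrow> subalgebra (P \<nu>) (received_algebra k)"
  using sets_received_obs[of k] sets_obs_P[of \<nu> k] space_P[of \<nu>] by (auto simp: subalgebra_def)

lemma delay_mono: "incseq (\<lambda>n. delay n k)"
  by (auto simp: incseq_def le_fun_def delay_def intro!: sum_mono2)

text \<open>The candidate is measurable for the received data by \<open>stat_received\<close> and
  \<open>alive_received\<close>. Every received event is a raw event, so
  \<open>nn_integral_delay\<close> applies to it, and monotone convergence removes the
  truncation.\<close>

lemma cond_delay:
  fixes k :: nat
  defines "\<nu> \<equiv> enat (Suc k)"
  shows "AE \<omega> in P \<nu>. indicator {\<omega>. alive k \<omega>} \<omega> * mean_delay (stat k \<omega>) =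
    nn_cond_exp (P \<nu>) (received_algebra k) (\<lambda>\<omega>. ennreal_of_enat (stop_time \<omega> + 1 - \<nu>)) \<omega>"
proof -
  have \<nu>: "1 \<le> \<nu>"
    by (simp add: \<nu>_def one_enat_def)
  interpret prob_space "P \<nu>"
    by (rule prob_P[OF \<nu>])
  interpret finite_measure_subalgebra "P \<nu>" "received_algebra k"
    by unfold_locales (rule received_subalgebra[OF \<nu>])
  note [measurable] = delay_measurable[OF \<nu>] alive_received
  have stat [measurable]: "stat k \<in> borel_measurable (received_algebra k)"
    by (rule stat_received) simp
  have [measurable]: "Measurable.pred (P \<nu>) (alive k)" "stat k \<in> borel_measurable (P \<nu>)"
    by (intro measurable_P_obs[OF \<nu> measurable_obs_received], measurable)+
  have T: "(\<lambda>\<omega>. ennreal_of_enat (stop_time \<omega> + 1 - \<nu>)) = (\<lambda>\<omega>. SUP n. delay n k \<omega>)"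
    unfolding \<nu>_def SUP_delay ..
  show ?thesis
    unfolding T
  proof (rule nn_cond_exp_charact)
    fix A assume A: "A \<in> sets (received_algebra k)"
    then have A_obs: "A \<in> sets (obs_algebra k)"
      using sets_received_obs by blast
    then have [measurable]: "A \<in> sets (P \<nu>)"
      using sets_obs_P[OF \<nu>] by blast
    have "(\<integral>\<^sup>+ \<omega>\<in>A. (SUP n. delay n k \<omega>) \<partial>P \<nu>) = (\<integral>\<^sup>+ \<omega>. (SUP n. delay n k \<omega> * indicator A \<omega>) \<partial>P \<nu>)"
      by (simp add: SUP_mult_right_ennreal)
    also have "\<dots> = (SUP n. \<integral>\<^sup>+ \<omega>\<in>A. delay n k \<omega> \<partial>P \<nu>)"
      using delay_mono[of k]
      by (intro nn_integral_monotone_convergence_SUP)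
         (auto simp: incseq_def le_fun_def intro!: mult_right_mono)
    also have "\<dots> = (SUP n. \<integral>\<^sup>+ \<omega>\<in>A. indicator {\<omega>. alive k \<omega>} \<omega> * mean_run n (stat k \<omega>) \<partial>P \<nu>)"
      using nn_integral_delay[OF \<nu> _ A_obs] by (simp add: \<nu>_def)
    also have "\<dots> = (\<integral>\<^sup>+ \<omega>. (SUP n. indicator {\<omega>. alive k \<omega>} \<omega> * mean_run n (stat k \<omega>) * indicator A \<omega>) \<partial>P \<nu>)"
      by (intro nn_integral_monotone_convergence_SUP[symmetric] incseq_SucI)
         (auto simp: le_fun_def simp del: mean_run.simps intro!: mult_right_mono mult_left_mono mean_run_mono_Suc)
    also have "\<dots> = (\<integral>\<^sup>+ \<omega>\<in>A. indicator {\<omega>. alive k \<omega>} \<omega> * mean_delay (stat k \<omega>) \<partial>P \<nu>)"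
      by (simp add: mean_delay_def SUP_mult_right_ennreal SUP_mult_left_ennreal)
    finally show "(\<integral>\<^sup>+ \<omega>\<in>A. (SUP n. delay n k \<omega>) \<partial>P \<nu>) =
      (\<integral>\<^sup>+ \<omega>\<in>A. indicator {\<omega>. alive k \<omega>} \<omega> * mean_delay (stat k \<omega>) \<partial>P \<nu>)" .
  qed measurable
qed

section \<open>Visits to zero before the change\<close>

lemma prob_X:
  assumes "1 \<le> \<nu>" "m \<in> {1..M}" "1 \<le> j" and [measurable]: "Measurable.pred borel R"
  shows "measure (P \<nu>) {\<omega> \<in> space (P \<nu>). R (X m j \<omega>)} =
    measure (density lborel (\<lambda>x. ennreal (if enat j < \<nu> then f0 m x else f1 m x))) {x. R x}"
proof -
  have X [measurable]: "X m j \<in> borel_measurable (P \<nu>)"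
    using assms by (intro X_measurable)
  have R: "{x. R x} \<in> sets lborel"
    by measurable
  have "X m j \<in> measurable (P \<nu>) lborel"
    using X by simp
  then show ?thesis
    unfolding distributed_distr_eq_density[OF distributed_X[OF assms(1-3)], symmetric]
    by (subst measure_distr[OF _ R]) (auto intro!: arg_cong[where f = "measure (P \<nu>)"])
qed

text \<open>
  If the log-likelihood ratio of the censored observation were almost surely positive before the
  change, then \<open>f1\<close> would exceed \<open>f0\<close> on the transmitted part and in total mass on the censored
  part, although both have mass 1.
\<close>

lemma prob_loglik_nonpos:
  assumes \<nu>: "1 \<le> \<nu>" and m: "m \<in> {1..M}" and j: "1 \<le> j" "enat j < \<nu>"
    and \<psi> [measurable]: "\<psi> \<in> measurable borel (count_space UNIV)"
  shows "0 < measure (P \<nu>) {\<omega> \<in> space (P \<nu>). loglik m \<psi> (\<psi> (X m j \<omega>)) (X m j \<omega>) \<le> 0}"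
proof (rule ccontr)
  assume contra: "\<not> ?thesis"
  note [measurable] = f0_measurable[OF m] f1_measurable[OF m]
  define D0 where "D0 = density lborel (\<lambda>x. ennreal (f0 m x))"
  define D1 where "D1 = density lborel (\<lambda>x. ennreal (f1 m x))"
  interpret D0: prob_space D0
    using density_f0[OF m] by (simp add: D0_def prob_density_def)
  interpret D1: prob_space D1
    using density_f1[OF m] by (simp add: D1_def prob_density_def)
  have sets [measurable_cong]: "sets D0 = sets borel" "sets D1 = sets borel"
    and space: "space D0 = UNIV" "space D1 = UNIV"
    by (simp_all add: D0_def D1_def)
  let ?c0 = "measure D0 {x. \<not> \<psi> x}" and ?c1 = "measure D1 {x. \<not> \<psi> x}"
  \<comment> \<open>With change point 1 the first observation is already post-change; with change
    point \<open>\<infinity>\<close> it is not.\<close>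
  have c: "\<P>(\<omega> in P 1. \<not> \<psi> (X m 1 \<omega>)) = ?c1" "\<P>(\<omega> in P \<infinity>. \<not> \<psi> (X m 1 \<omega>)) = ?c0"
    using prob_X[OF _ m, of 1 1 "\<lambda>x. \<not> \<psi> x"] prob_X[OF _ m, of \<infinity> 1 "\<lambda>x. \<not> \<psi> x"]
    by (simp_all add: D0_def D1_def one_enat_def)
  have loglik: "loglik m \<psi> (\<psi> x) x = (if \<psi> x then ln (f1 m x / f0 m x) else ln (?c1 / ?c0))" for x
    unfolding llr_def c by simp
  have [measurable]: "(\<lambda>x. loglik m \<psi> (\<psi> x) x) \<in> borel_measurable borel"
    by (intro loglik_measurable m) measurable
  have "measure D0 {x. loglik m \<psi> (\<psi> x) x \<le> 0} = 0"
    using contra prob_X[OF \<nu> m j(1), of "\<lambda>x. loglik m \<psi> (\<psi> x) x \<le> 0"] j(2)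
    by (simp add: D0_def zero_less_measure_iff)
  then have "AE x in D0. 0 < loglik m \<psi> (\<psi> x) x"
    by (subst (asm) D0.prob_eq_0) (auto simp: space not_le)
  then have pos: "AE x in lborel. 0 < f0 m x \<longrightarrow> 0 < loglik m \<psi> (\<psi> x) x"
    unfolding D0_def by (subst (asm) AE_density) auto
  \<comment> \<open>Division by 0 gives 0 and \<open>ln 0\<close> is not positive in HOL, so a
    positive logarithm excludes the degenerate quotients.\<close>
  have gt: "y < x" if "0 < ln (x / y)" "0 \<le> x" "0 \<le> y" for x y :: real
  proof -
    have "x \<noteq> 0" "y \<noteq> 0"
      using that by auto
    then have "1 < x / y"
      using that by (subst (asm) ln_gt_zero_iff) auto
    then show ?thesis
      using that \<open>y \<noteq> 0\<close> by (simp add: field_simps)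
  qed
  have f_gt: "AE x in lborel. \<psi> x \<and> 0 < f0 m x \<longrightarrow> f0 m x < f1 m x"
    using pos
  proof eventually_elim
    case (elim x)
    then show ?case
      using gt[of "f1 m x" "f0 m x"] by (auto simp: loglik f0_nonneg[OF m] f1_nonneg[OF m])
  qed
  show False
  \<comment> \<open>If nothing is censored before the change, strictness must come from the
    densities. Otherwise it comes from the censored part, whose constant log-ratio is then
    positive.\<close>
  proof (cases "?c0 = 0")
    case True
    have "AE x in D0. \<psi> x"
      using True by (subst (asm) D0.prob_eq_0) (auto simp: space)
    then have "AE x in lborel. 0 < f0 m x \<longrightarrow> \<psi> x"
      unfolding D0_def by (subst (asm) AE_density) auto
    with f_gt have f_gt': "AE x in lborel. 0 < f0 m x \<longrightarrow> f0 m x < f1 m x"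
      by eventually_elim auto
    have one: "(\<integral>\<^sup>+ x. f0 m x \<partial>lborel) = 1" "(\<integral>\<^sup>+ x. f1 m x \<partial>lborel) = 1"
      using D0.emeasure_space_1 D1.emeasure_space_1 by (simp_all add: D0_def D1_def emeasure_density)
    have "(\<integral>\<^sup>+ x. f0 m x \<partial>lborel) < (\<integral>\<^sup>+ x. f1 m x \<partial>lborel)"
    proof (rule nn_integral_less)
      show "AE x in lborel. ennreal (f0 m x) \<le> ennreal (f1 m x)"
        using f_gt'
      proof eventually_elim
        case (elim x)
        then show ?case
          using f0_nonneg[OF m, of x] f1_nonneg[OF m, of x] by (intro ennreal_leI) linarith
      qed
      \<comment> \<open>The reverse inequality would leave no room for points with
        \<open>f0 m x > 0\<close>, contradicting total mass 1.\<close>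
      show "\<not> (AE x in lborel. ennreal (f1 m x) \<le> ennreal (f0 m x))"
      proof
        assume "AE x in lborel. ennreal (f1 m x) \<le> ennreal (f0 m x)"
        with f_gt' have "AE x in lborel. ennreal (f0 m x) = 0"
        proof eventually_elim
          case (elim x)
          then show ?case
            using f0_nonneg[OF m, of x] by (auto simp: ennreal_le_iff ennreal_eq_0_iff not_less)
        qed
        then have "(\<integral>\<^sup>+ x. f0 m x \<partial>lborel) = 0"
          by (subst nn_integral_0_iff_AE) auto
        then show False
          using one by simp
      qed
    qed (auto simp: one)
    then show False
      by (simp add: one)
  next
    case False
    have "\<not> (AE x in D0. \<psi> x)"
      using False by (subst (asm) D0.prob_eq_0) (auto simp: space)
    moreover have "AE x in D0. \<psi> x" if "\<not> 0 < ln (?c1 / ?c0)"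
      using \<open>AE x in D0. 0 < loglik m \<psi> (\<psi> x) x\<close>
      by eventually_elim (use that in \<open>auto simp: loglik split: if_splits\<close>)
    ultimately have "?c0 < ?c1"
      using gt[of ?c1 ?c0] by auto
    moreover have "measure D0 {x. \<psi> x} \<le> measure D1 {x. \<psi> x}"
    proof -
      have "emeasure D0 {x. \<psi> x} \<le> emeasure D1 {x. \<psi> x}"
        unfolding D0_def D1_def
      proof (subst (1 2) emeasure_density; (intro nn_integral_mono_AE)?)
        show "AE x in lborel. ennreal (f0 m x) * indicator {x. \<psi> x} x \<le> ennreal (f1 m x) * indicator {x. \<psi> x} x"
          using f_gt
        proof eventually_elim
          case (elim x)
          then show ?case
            using f0_nonneg[OF m, of x] f1_nonneg[OF m, of x]
            by (cases "f0 m x = 0") (auto simp: indicator_def intro!: ennreal_leI)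
        qed
      qed auto
      then show ?thesis
        by (simp add: D0.emeasure_eq_measure D1.emeasure_eq_measure)
    qed
    moreover have "measure D0 {x. \<psi> x} = 1 - ?c0" "measure D1 {x. \<psi> x} = 1 - ?c1"
      using D0.prob_compl[of "{x. \<not> \<psi> x}"] D1.prob_compl[of "{x. \<not> \<psi> x}"]
      by (simp_all add: space set_diff_eq)
    ultimately show False
      by simp
  qed
qed

text \<open>A nonpositive increment leads from 0 back to 0; the reset to \<open>a1\<close> cannot
  fire, as it would require \<open>0 < a1\<close> and \<open>a1 \<le> 0\<close>. The strategies thus
  stay frozen at those for state 0, and the hypothesis becomes a condition on each observation
  separately.\<close>

lemma stat_eq_0:
  assumes "\<And>m j. m \<in> {1..M} \<Longrightarrow> j \<in> {1..k} \<Longrightarrow> loglik m (strat m 0) (strat m 0 (X m j \<omega>)) (X m j \<omega>) \<le> 0"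
  shows "j \<le> k \<Longrightarrow> stat j \<omega> = 0"
proof (induction j)
  case (Suc j)
  have "increment 0 (\<lambda>m\<in>{1..M}. X m (Suc j) \<omega>) \<le> 0"
    unfolding increment_def using assms Suc.prems by (intro sum_nonpos) auto
  then show ?case
    using Suc by (simp only: stat_Suc step_def) (auto simp: cap_def max_def)
qed simp

text \<open>With change point \<open>Suc k\<close> all times up to \<open>k\<close> are before the
  change. The event contains a finite intersection of independent events, each of positive
  probability by \<open>prob_loglik_nonpos\<close>.\<close>

lemma prob_stat_eq_0:
  "0 < measure (P (enat (Suc k))) {\<omega> \<in> space (P \<infinity>). \<forall>j\<le>k. stat j \<omega> = 0}"
proof -
  let ?P = "P (enat (Suc k))"
  have \<nu>: "1 \<le> enat (Suc k)"
    by (simp add: one_enat_def)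
  interpret prob_space ?P
    by (rule prob_P[OF \<nu>])
  have [measurable]: "stat j \<in> borel_measurable ?P" if "j \<le> k" for j
    by (rule measurable_P_obs[OF \<nu> stat_obs[OF that]])
  have Z: "{\<omega> \<in> space ?P. \<forall>j\<le>k. stat j \<omega> = 0} \<in> events"
  proof -
    have "{\<omega> \<in> space ?P. \<forall>j\<in>{..k}. stat j \<omega> = 0} \<in> events"
      by measurable
    then show ?thesis by simp
  qed
  show ?thesis
  proof (cases "k = 0")
    case True
    then show ?thesis
      using prob_space by (simp add: space_P[OF \<nu>, symmetric])
  next
    case False
    define I where "I = {1..M} \<times> {1..k}"
    define L where "L i = {x. loglik (fst i) (strat (fst i) 0) (strat (fst i) 0 x) x \<le> 0}" for i :: "nat \<times> nat"
    let ?X = "\<lambda>(m, j). X m j"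
    have strat: "strat m 0 \<in> measurable borel (count_space UNIV)" if "m \<in> {1..M}" for m
      unfolding ac_strategy_def[abs_def]
      using full_measurable[OF that] censored_measurable[OF that] by (cases "a1 \<le> 0") simp_all
    have L: "L i \<in> sets borel" if "i \<in> I" for i
    proof -
      have m: "fst i \<in> {1..M}"
        using that by (auto simp: I_def)
      have [measurable]: "(\<lambda>x. loglik (fst i) (strat (fst i) 0) (strat (fst i) 0 x) x) \<in> borel_measurable borel"
        using strat[OF m] by (intro loglik_measurable m) auto
      show ?thesis
        unfolding L_def by measurable
    qed
    have "prob (\<Inter>i\<in>I. ?X i -` L i \<inter> space ?P) = (\<Prod>i\<in>I. prob (?X i -` L i \<inter> space ?P))"
    proof (rule indep_varsD[OF indep_X[OF \<nu>]])
      show "I \<noteq> {}" "finite I" "I \<subseteq> {1..M} \<times> {1..}"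
        using M_pos False by (auto simp: I_def)
    qed (rule L)
    also have "0 < \<dots>"
    proof (rule prod_pos)
      fix i assume "i \<in> I"
      then obtain m j where i: "i = (m, j)" "m \<in> {1..M}" "1 \<le> j" "j \<le> k"
        by (auto simp: I_def)
      have "?X i -` L i \<inter> space ?P =
          {\<omega> \<in> space ?P. loglik m (strat m 0) (strat m 0 (X m j \<omega>)) (X m j \<omega>) \<le> 0}"
        by (auto simp: i L_def)
      then show "0 < prob (?X i -` L i \<inter> space ?P)"
        using prob_loglik_nonpos[OF \<nu> i(2,3) _ strat[OF i(2)]] i(4) by simp
    qed
    also have "prob (\<Inter>i\<in>I. ?X i -` L i \<inter> space ?P) \<le> prob {\<omega> \<in> space ?P. \<forall>j\<le>k. stat j \<omega> = 0}"
    proof (rule finite_measure_mono[OF subsetI Z])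
      fix \<omega> assume \<omega>: "\<omega> \<in> (\<Inter>i\<in>I. ?X i -` L i \<inter> space ?P)"
      have X_L: "loglik m (strat m 0) (strat m 0 (X m j \<omega>)) (X m j \<omega>) \<le> 0" and space: "\<omega> \<in> space ?P"
        if "m \<in> {1..M}" "j \<in> {1..k}" for m j
        using INT_D[OF \<omega>, of "(m, j)"] that by (simp_all add: I_def L_def)
      have "stat j \<omega> = 0" if "j \<le> k" for j
        by (rule stat_eq_0[OF X_L that])
      \<comment> \<open>Membership in the sample space is read off the index \<open>(1, 1)\<close>,
        which lies in \<open>I\<close> since \<open>M\<close> and \<open>k\<close> are
        positive.\<close>
      then show "\<omega> \<in> {\<omega> \<in> space ?P. \<forall>j\<le>k. stat j \<omega> = 0}"
        using space[of 1 1] M_pos False by simp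
    qed
    finally show ?thesis
      by (simp add: space_P[OF \<nu>])
  qed
qed

section \<open>The essential supremum of the conditional delay\<close>

lemma worst_case_delay_eq:
  assumes "1 \<le> \<nu>"
  shows "worst_case_delay M P X stop_time policy \<nu> = mean_delay 0"
proof -
  define k where "k = \<nu> - 1"
  have \<nu>_eq: "\<nu> = Suc k"
    using assms by (simp add: k_def)
  have \<nu>: "1 \<le> enat \<nu>"
    using assms by (simp add: one_enat_def)
  interpret prob_space "P (enat \<nu>)"
    by (rule prob_P[OF \<nu>])
  let ?P = "P (enat \<nu>)"
  let ?c = "nn_cond_exp ?P (received_algebra k) (\<lambda>\<omega>. ennreal_of_enat (stop_time \<omega> + 1 - enat \<nu>))"
  have AE: "AE \<omega> in ?P. indicator {\<omega>. alive k \<omega>} \<omega> * mean_delay (stat k \<omega>) = ?c \<omega>"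
    unfolding \<nu>_eq by (rule cond_delay)
  have "esssup ?P ?c = mean_delay 0"
  proof (rule antisym)
    have "AE \<omega> in ?P. ?c \<omega> \<le> mean_delay 0"
      using AE
    proof eventually_elim
      case (elim \<omega>)
      have "indicator {\<omega>. alive k \<omega>} \<omega> * mean_delay (stat k \<omega>) \<le> mean_delay 0"
        using mean_delay_antimono[OF stat_nonneg[of k \<omega>]] by (simp add: indicator_def)
      then show ?case
        by (simp only: elim)
    qed
    \<comment> \<open>On a nonmeasurable function \<open>esssup\<close> takes the top value, so an
      upper bound has to establish measurability.\<close>
    moreover have "?c \<in> borel_measurable ?P"
      by (rule measurable_from_subalg[OF received_subalgebra[OF \<nu>, of k]]) simp
    ultimately show "esssup ?P ?c \<le> mean_delay 0"
      by (intro esssup_I)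
    show "mean_delay 0 \<le> esssup ?P ?c"
    proof (rule ccontr)
      \<comment> \<open>Zeros at all times up to \<open>k\<close> are demanded, since
        \<open>alive k\<close> looks at the whole past.\<close>
      let ?Z = "{\<omega> \<in> space ?P. \<forall>j\<le>k. stat j \<omega> = 0}"
      assume less: "\<not> mean_delay 0 \<le> esssup ?P ?c"
      have "AE \<omega> in ?P. \<not> (\<forall>j\<le>k. stat j \<omega> = 0)"
        using AE esssup_AE[of ?c ?P]
      proof eventually_elim
        case (elim \<omega>)
        show ?case
        proof
          assume zero: "\<forall>j\<le>k. stat j \<omega> = 0"
          then have "alive k \<omega>"
            using threshold_pos by (simp add: alive_def)
          then have "?c \<omega> = mean_delay 0"
            using elim(1) zero by simp
          then show False
            using elim(2) less by simp
        qed
      qed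
      then have Z_AE: "AE \<omega> in ?P. \<omega> \<notin> ?Z"
        by eventually_elim blast
      have "prob ?Z = 0"
      \<comment> \<open>A set outside the sigma-algebra has \<open>measure\<close> 0 by convention,
        so both cases give the same value.\<close>
      proof (cases "?Z \<in> events")
        case True
        then show ?thesis
          by (rule prob_eq_0[THEN iffD2, OF _ Z_AE])
      next
        case False
        then show ?thesis
          by (rule measure_notin_sets)
      qed
      moreover have "0 < prob ?Z"
        unfolding space_P[OF \<nu>] unfolding \<nu>_eq by (rule prob_stat_eq_0)
      ultimately show False
        by linarith
    qed
  qed
  then show ?thesis
    unfolding worst_case_delay_def space_P[OF \<nu>] k_def .
qed

end

theorem theorem3:
  fixes M :: nat
    and f0 f1 :: "nat \<Rightarrow> real \<Rightarrow> real"
    and P :: "enat \<Rightarrow> 'a measure"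
    and X :: "nat \<Rightarrow> nat \<Rightarrow> 'a \<Rightarrow> real"
    and \<psi>opt :: "nat \<Rightarrow> real \<Rightarrow> strategy"
    and a a1 :: real
    and \<epsilon> :: "nat \<Rightarrow> real"
    and \<nu> :: nat
  assumes "sensor_network M f0 f1 P X"
    and "\<And>m. m \<in> {1..M} \<Longrightarrow> 0 < kl_info (f1 m) (f0 m) \<and> kl_info (f1 m) (f0 m) < \<infinity>"
    and "\<And>m. m \<in> {1..M} \<Longrightarrow> 0 < kl_info (f0 m) (f1 m) \<and> kl_info (f0 m) (f1 m) < \<infinity>"
    and "\<And>m e. m \<in> {1..M} \<Longrightarrow> 0 < e \<Longrightarrow> e \<le> 1 \<Longrightarrow> optimal_strategy f0 f1 P X m e (\<psi>opt m e)"
    and "\<And>m. m \<in> {1..M} \<Longrightarrow> \<psi>opt m 1 = (\<lambda>_. True)"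
    and "0 < a" and "a1 < a"
    and "\<And>m. m \<in> {1..M} \<Longrightarrow> 0 < \<epsilon> m \<and> \<epsilon> m \<le> 1"
    and "1 \<le> \<nu>"
  shows "lorden_delay M P X
           (ac_time M f0 f1 P X \<psi>opt a1 \<epsilon> a) (ac_policy M f0 f1 P X \<psi>opt a1 \<epsilon>)
         = worst_case_delay M P X
           (ac_time M f0 f1 P X \<psi>opt a1 \<epsilon> a) (ac_policy M f0 f1 P X \<psi>opt a1 \<epsilon>) \<nu>"
proof -
  \<comment> \<open>A maximizer is in particular feasible, and feasible strategies are
    measurable.\<close>
  have measurable: "\<psi>opt m e \<in> measurable borel (count_space UNIV)"
    if "m \<in> {1..M}" "0 < e" "e \<le> 1" for m e
    using assms(4)[OF that] by (simp add: optimal_strategy_def is_arg_max_def)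
  interpret sensor_network M f0 f1 P X
    by (rule assms(1))
  interpret cusum_ac M f0 f1 P X \<psi>opt a a1 \<epsilon>
    by unfold_locales (use assms measurable in auto)
  have "lorden_delay M P X stop_time policy = (SUP \<nu> \<in> {1::nat..}. mean_delay 0)"
    unfolding lorden_delay_def by (intro SUP_cong) (auto simp: worst_case_delay_eq)
  also have "\<dots> = worst_case_delay M P X stop_time policy \<nu>"
    using assms(9) by (simp add: worst_case_delay_eq)
  finally show ?thesis .
qed

end
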